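(* For every natural number $m\ge1$ there exists a left-symmetric superalgebra on the Lie superalgebra $\mathfrak{sl}(m+1|m)$ over $\mathbb{C}$.
   Context: All vector spaces and algebras are over $\mathbb{C}$. A superalgebra is a $\mathbb{Z}_2$-graded vector space $\mathcal L=\mathcal L_{\bar 0}\oplus\mathcal L_{\bar 1}$ with a bilinear product satisfying $\mathcal L_{\gamma'}\cdot\mathcal L_{\gamma''}\subseteq\mathcal L_{\gamma'+\gamma''}$. It is a left-symmetric superalgebra (LSSA) if for all homogeneous $x,y,z\in\mathcal L$: $(x\cdot y)\cdot z-x\cdot(y\cdot z)=(-1)^{|x||y|}\big((y\cdot x)\cdot z-y\cdot(x\cdot z)\big)$. An LSSA on a Lie superalgebra $\mathfrak g$ is an LSSA product on the $\mathbb{Z}_2$-graded vector space $\mathfrak g$ such that $x\cdot y-(-1)^{|x||y|}y\cdot x=[x,y]$ for all homogeneous $x,y\in\mathfrak g$. $\mathfrak{gl}(p|q)$ is the space of $(p+q)\times(p+q)$ complex matrices $X=\begin{pmatrix} X_1 & X_2 \\ X_3 & X_4 \end{pmatrix}$ with blocks of sizes $p\times p$, $p\times q$, $q\times p$, $q\times q$; the even part is $X_2=X_3=0$, the odd part is $X_1=X_4=0$, and the bracket is $[X,Y]=XY-(-1)^{|X||Y|}YX$. $\mathfrak{sl}(p|q)=\{X\in\mathfrak{gl}(p|q): \mathrm{tr}(X_1)-\mathrm{tr}(X_4)=0\}$. *)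

theory Defs
  imports Complex_Main "HOL-Library.Z2" "Jordan_Normal_Form.VS_Connect"
begin

text \<open>The field \<^const>\<open>mult\<close> of the record holds the (not necessarily associative) product or the
  bracket; the field \<^const>\<open>one\<close>, inherited from \<^type>\<open>module\<close>, carries no meaning here.
  Degrees live in \<^typ>\<open>bit\<close>, the integers mod 2.\<close>

record ('a, 'b) graded_module = "('a, 'b) module" +
  part :: "bit \<Rightarrow> 'b set"

definition super_sign :: "bit \<Rightarrow> bit \<Rightarrow> complex" where
  "super_sign a b = (if a * b = 1 then - 1 else 1)"

locale super_vector_space =
  vectorspace "class_ring :: complex ring" L
  for L :: "(complex, 'v, 'm) graded_module_scheme" (structure) +
  assumes part_submodule: "submodule class_ring (part L a) L"
    and part_sum: "x \<in> carrier L \<Longrightarrow> \<exists>y \<in> part L 0. \<exists>z \<in> part L 1. x = y \<oplus> z"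
    and part_Int: "part L 0 \<inter> part L 1 = {\<zero>}"

locale superalgebra = super_vector_space L
  for L :: "(complex, 'v, 'm) graded_module_scheme" (structure) +
  assumes prod_closed: "\<lbrakk>x \<in> carrier L; y \<in> carrier L\<rbrakk> \<Longrightarrow> x \<otimes> y \<in> carrier L"
    and prod_add_left:
      "\<lbrakk>x \<in> carrier L; y \<in> carrier L; z \<in> carrier L\<rbrakk> \<Longrightarrow> (x \<oplus> y) \<otimes> z = x \<otimes> z \<oplus> y \<otimes> z"
    and prod_add_right:
      "\<lbrakk>x \<in> carrier L; y \<in> carrier L; z \<in> carrier L\<rbrakk> \<Longrightarrow> z \<otimes> (x \<oplus> y) = z \<otimes> x \<oplus> z \<otimes> y"
    and prod_smult_left:
      "\<lbrakk>x \<in> carrier L; y \<in> carrier L\<rbrakk> \<Longrightarrow> (c \<odot> x) \<otimes> y = c \<odot> (x \<otimes> y)"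
    and prod_smult_right:
      "\<lbrakk>x \<in> carrier L; y \<in> carrier L\<rbrakk> \<Longrightarrow> x \<otimes> (c \<odot> y) = c \<odot> (x \<otimes> y)"
    and prod_part: "\<lbrakk>x \<in> part L a; y \<in> part L b\<rbrakk> \<Longrightarrow> x \<otimes> y \<in> part L (a + b)"

locale left_symmetric_superalgebra = superalgebra L
  for L :: "(complex, 'v, 'm) graded_module_scheme" (structure) +
  assumes left_symmetric:
    "\<lbrakk>x \<in> part L a; y \<in> part L b; z \<in> part L c\<rbrakk> \<Longrightarrow>
      (x \<otimes> y) \<otimes> z \<ominus> x \<otimes> (y \<otimes> z) = super_sign a b \<odot> ((y \<otimes> x) \<otimes> z \<ominus> y \<otimes> (x \<otimes> z))"

locale lie_superalgebra = superalgebra L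
  for L :: "(complex, 'v, 'm) graded_module_scheme" (structure) +
  assumes skew_symmetric:
    "\<lbrakk>x \<in> part L a; y \<in> part L b\<rbrakk> \<Longrightarrow> x \<otimes> y = \<ominus> (super_sign a b \<odot> (y \<otimes> x))"
    and jacobi:
    "\<lbrakk>x \<in> part L a; y \<in> part L b; z \<in> part L c\<rbrakk> \<Longrightarrow>
      x \<otimes> (y \<otimes> z) = (x \<otimes> y) \<otimes> z \<oplus> super_sign a b \<odot> (y \<otimes> (x \<otimes> z))"

text \<open>An LSSA product \<open>p\<close> on a Lie superalgebra \<open>\<gg>\<close> lives on the same graded vector space:
  only the \<^const>\<open>mult\<close> field is replaced.\<close>

locale lssa_on =
  lie: lie_superalgebra \<gg> + lssa: left_symmetric_superalgebra "\<gg>\<lparr>mult := p\<rparr>"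
  for \<gg> :: "(complex, 'v, 'm) graded_module_scheme" and p :: "'v \<Rightarrow> 'v \<Rightarrow> 'v" +
  assumes compatible: "\<lbrakk>x \<in> part \<gg> a; y \<in> part \<gg> b\<rbrakk> \<Longrightarrow>
    p x y \<ominus>\<^bsub>\<gg>\<^esub> super_sign a b \<odot>\<^bsub>\<gg>\<^esub> p y x = x \<otimes>\<^bsub>\<gg>\<^esub> y"

definition mat_trace :: "complex mat \<Rightarrow> complex" where
  "mat_trace A = (\<Sum>i<dim_row A. A $$ (i, i))"

definition supertrace :: "nat \<Rightarrow> complex mat \<Rightarrow> complex" where
  "supertrace p X = (case split_block X p p of (X1, X2, X3, X4) \<Rightarrow> mat_trace X1 - mat_trace X4)"

definition gl_part :: "nat \<Rightarrow> nat \<Rightarrow> bit \<Rightarrow> complex mat set" where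
  "gl_part p q a = {X \<in> carrier_mat (p + q) (p + q).
     case split_block X p p of (X1, X2, X3, X4) \<Rightarrow>
       if a = 0 then X2 = 0\<^sub>m p q \<and> X3 = 0\<^sub>m q p else X1 = 0\<^sub>m p p \<and> X4 = 0\<^sub>m q q}"

definition gl_component :: "nat \<Rightarrow> nat \<Rightarrow> bit \<Rightarrow> complex mat \<Rightarrow> complex mat" where
  "gl_component p q a X = (case split_block X p p of (X1, X2, X3, X4) \<Rightarrow>
     if a = 0 then four_block_mat X1 (0\<^sub>m p q) (0\<^sub>m q p) X4
     else four_block_mat (0\<^sub>m p p) X2 X3 (0\<^sub>m q q))"

text \<open>The bracket of homogeneous elements, extended bilinearly to arbitrary matrices.\<close>

definition gl_bracket :: "nat \<Rightarrow> nat \<Rightarrow> complex mat \<Rightarrow> complex mat \<Rightarrow> complex mat" where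
  "gl_bracket p q X Y =
    (let br = (\<lambda>a b. gl_component p q a X * gl_component p q b Y
                 - super_sign a b \<cdot>\<^sub>m (gl_component p q b Y * gl_component p q a X))
     in br 0 0 + br 0 1 + br 1 0 + br 1 1)"

definition gl_super :: "nat \<Rightarrow> nat \<Rightarrow> (complex, complex mat) graded_module" where
  "gl_super p q = \<lparr>carrier = carrier_mat (p + q) (p + q), mult = gl_bracket p q, one = undefined,
     zero = 0\<^sub>m (p + q) (p + q), add = (+), smult = (\<cdot>\<^sub>m), part = gl_part p q\<rparr>"

definition sl_super :: "nat \<Rightarrow> nat \<Rightarrow> (complex, complex mat) graded_module" where
  "sl_super p q = (gl_super p q)
     \<lparr>carrier := {X \<in> carrier (gl_super p q). supertrace p X = 0},
      part := \<lambda>a. {X \<in> part (gl_super p q) a. supertrace p X = 0}\<rparr>"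

end

(*
  Write U + W for the natural module of gl(m+1|m). Two copies of its super exterior square
  form a module V with dim V = dim sl(m+1|m), whose odd part consists of pairs of (m+1) x m matrices.
  The orbit map X -> X.v at the Kronecker pencil v = (P, Q), with P = [I; 0] and Q = [0; I], is a
  parity-reversing linear bijection from sl(m+1|m) to V: the equation X.v = 0 forces the even blocks
  of X to be Toeplitz, hence scalar of supertrace zero, and makes the odd blocks vanish along their
  antidiagonals. Pulling the action back along the orbit map gives the product x y defined by
  (x y).v = x.(y.v), and left symmetry and compatibility with the bracket are the representation
  property.
*)

theory Submission
  imports Defs "HOL-Library.Function_Algebras"
begin

section \<open>Modules with an etale vector\<close>

text \<open>One super exterior square has dimension 2m(m+1), half of (2m+1)^2 - 1 = dim sl(m+1|m);
  this is why two copies are taken. The two parts of sl(m+1|m) and the two parts of V then all have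
  dimension 2m(m+1), so dimensions alone do not fix the parity of v. An even v is impossible: the
  pair of symmetric m x m matrices contained in it is moved by gl(m) alone under the even part, and
  m^2 < m(m+1). For odd v the even part acts on pencils of (m+1) x m matrices, and by Kronecker's
  classification the generic pencil of this shape is equivalent to (P, Q). Its stabilizer in gl(m+1)
  + gl(m) is the line of pairs (a I, -a I), of supertrace (2m+1) a, so passing to sl removes exactly
  this line. Surjectivity of the orbit map then has to come from injectivity, although matrices and
  module vectors live in spaces of different kinds; it is obtained from an injective endomorphism of
  V that factors through the orbit map.\<close>

declare add_bit_eq_xor [simp del]

section \<open>Injective endomorphisms of finite-dimensional subspaces\<close>

context vector_space
begin

text \<open>Dimension count relative to \<open>V\<close>, inside an ambient space that may be
  infinite-dimensional. A basis \<open>B\<close> of \<open>V\<close> has an independent image of the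
  same size; a vector of \<open>V\<close> outside the span of that image would yield more than
  \<open>card B\<close> independent vectors in \<open>span B\<close>.\<close>

lemma linear_inj_on_subspace_imp_surj:
  assumes lin: "Vector_Spaces.linear scale scale f"
    and sub: "subspace V" and fin: "finite T" "V \<subseteq> span T"
    and maps: "f ` V \<subseteq> V" and inj: "inj_on f V"
  shows "f ` V = V"
proof
  interpret f: Vector_Spaces.linear scale scale f by (fact lin)
  obtain B where B: "B \<subseteq> V" "independent B" "V \<subseteq> span B"
    using maximal_independent_subset by blast
  have finB: "finite B"
    using independent_span_bound[OF fin(1) B(2)] B(1) fin(2) by blast
  have spanB: "span B = V"
    using B(1,3) sub by (simp add: span_minimal subset_antisym)
  have ind: "independent (f ` B)"
    using inj spanB B(2) by (simp add: f.independent_inj_on_image)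
  have card: "card (f ` B) = card B"
    using inj B(1) by (meson card_image inj_on_subset)
  have "w \<in> span (f ` B)" if "w \<in> V" for w
  proof (rule ccontr)
    assume w: "w \<notin> span (f ` B)"
    then have "independent (insert w (f ` B))"
      using ind independent_insertI by blast
    moreover have "insert w (f ` B) \<subseteq> span B"
      using spanB that maps B(1) by blast
    ultimately have "card (insert w (f ` B)) \<le> card B"
      using independent_span_bound[OF finB] by blast
    moreover have "w \<notin> f ` B"
      using w span_base by blast
    ultimately show False
      using card finB by simp
  qed
  then show "V \<subseteq> f ` V"
    using f.span_image spanB by blast
qed (fact maps)

end

section \<open>Signs, and changing the product on a graded space\<close>

lemma super_sign_simps [simp]:
  "super_sign a b * super_sign a b = 1"
  "super_sign a b * (super_sign a b * c) = c"
  "super_sign 0 a = 1" "super_sign a 0 = 1" "super_sign 1 1 = -1"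
  by (auto simp: super_sign_def)

lemma super_sign_commute: "super_sign a b = super_sign b a"
  by (simp add: super_sign_def mult.commute)

lemma super_sign_add_right: "super_sign a (b + c) = super_sign a b * super_sign a c"
  by (cases a; cases b; cases c; simp add: super_sign_def)

lemma super_sign_add_left: "super_sign (a + b) c = super_sign a c * super_sign b c"
  using super_sign_add_right[of c a b] by (simp only: super_sign_commute[of c])

text \<open>The graded vector space axioms do not mention the product, but a record with another
  \<open>mult\<close> field is a different term, so the locale predicates are established anew for
  it.\<close>

lemma super_vector_space_mult_update:
  assumes "super_vector_space L"
  shows "super_vector_space (L\<lparr>mult := p\<rparr>)"
proof -
  interpret super_vector_space L by fact
  have ag: "abelian_group (L\<lparr>mult := p\<rparr>)"
    by (rule abelian_groupI) (auto simp: M.a_assoc M.a_comm M.a_lcomm intro: M.a_closed M.l_neg M.a_inv_closed)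
  have md: "module (class_ring :: complex ring) (L\<lparr>mult := p\<rparr>)"
    by (rule moduleI[OF class_cring.is_cring ag])
      (use smult_l_distr smult_r_distr smult_assoc1 smult_one in auto)
  then have sub: "submodule class_ring (part L a) (L\<lparr>mult := p\<rparr>)" for a
    using part_submodule[of a] by (simp add: submodule_def)
  show ?thesis
    using md sub part_sum part_Int
    by (simp add: super_vector_space_def super_vector_space_axioms_def vectorspace_def class_field.field_axioms)
qed

text \<open>Since \<open>v\<close> is odd, its orbit map reverses parity; this is harmless because the product
  applies the orbit map once and inverts it once.\<close>

locale etale_module = superalgebra L + W: vector_space sc
  for L :: "(complex, 'v, 'm) graded_module_scheme" (structure)
    and sc :: "complex \<Rightarrow> 'w::ab_group_add \<Rightarrow> 'w" +
  fixes act :: "'v \<Rightarrow> 'w \<Rightarrow> 'w" and V :: "bit \<Rightarrow> 'w set" and v :: 'w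
  assumes act_add_left:
      "\<lbrakk>x \<in> carrier L; y \<in> carrier L\<rbrakk> \<Longrightarrow> act (x \<oplus> y) w = act x w + act y w"
    and act_smult_left: "x \<in> carrier L \<Longrightarrow> act (c \<odot> x) w = sc c (act x w)"
    and act_linear: "x \<in> carrier L \<Longrightarrow> Vector_Spaces.linear sc sc (act x)"
    and act_bracket: "\<lbrakk>x \<in> part L a; y \<in> part L b\<rbrakk> \<Longrightarrow>
      act (x \<otimes> y) w = act x (act y w) - sc (super_sign a b) (act y (act x w))"
    and V_subspace: "W.subspace (V a)"
    and V_Int: "V 0 \<inter> V 1 = {0}"
    and act_V: "\<lbrakk>x \<in> part L a; w \<in> V b\<rbrakk> \<Longrightarrow> act x w \<in> V (a + b)"
    and v_in: "v \<in> V 1"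
    and orbit_inj: "\<lbrakk>x \<in> carrier L; act x v = 0\<rbrakk> \<Longrightarrow> x = \<zero>"
    and orbit_closed: "\<lbrakk>x \<in> carrier L; y \<in> carrier L\<rbrakk> \<Longrightarrow>
      \<exists>z \<in> carrier L. act z v = act x (act y v)"
begin

lemma part_carrier: "x \<in> part L a \<Longrightarrow> x \<in> carrier L"
  using part_submodule submodule.subset by blast

text \<open>The chosen element exists by \<open>orbit_closed\<close> and is unique by
  \<open>orbit_inj\<close>, so on \<open>carrier L\<close> this is the action pulled back along the
  orbit map.\<close>

definition orbit_prod :: "'v \<Rightarrow> 'v \<Rightarrow> 'v" where
  "orbit_prod x y = (SOME z. z \<in> carrier L \<and> act z v = act x (act y v))"

lemma orbit_prod:
  assumes "x \<in> carrier L" "y \<in> carrier L"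
  shows orbit_prod_closed: "orbit_prod x y \<in> carrier L"
    and act_orbit_prod: "act (orbit_prod x y) v = act x (act y v)"
  using someI_ex[of "\<lambda>z. z \<in> carrier L \<and> act z v = act x (act y v)"] orbit_closed[OF assms]
  unfolding orbit_prod_def by blast+

lemma act_right:
  assumes "x \<in> carrier L"
  shows act_add_right: "act x (w + w') = act x w + act x w'"
    and act_diff_right: "act x (w - w') = act x w - act x w'"
    and act_scale_right: "act x (sc c w) = sc c (act x w)"
proof -
  interpret Vector_Spaces.linear sc sc "act x" by (rule act_linear) fact
  show "act x (w + w') = act x w + act x w'" "act x (w - w') = act x w - act x w'"
    "act x (sc c w) = sc c (act x w)"
    by (fact add diff scale)+
qed

lemma act_zero_left: "act \<zero> w = 0"
  using act_add_left[of \<zero> \<zero> w] by simp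

lemma act_uminus_left: "x \<in> carrier L \<Longrightarrow> act (\<ominus> x) w = - act x w"
  using act_add_left[of x "\<ominus> x" w] by (simp add: M.r_neg act_zero_left add_eq_0_iff)

lemma act_minus_left:
  "\<lbrakk>x \<in> carrier L; y \<in> carrier L\<rbrakk> \<Longrightarrow> act (x \<ominus> y) w = act x w - act y w"
  by (simp add: a_minus_def act_add_left act_uminus_left)

text \<open>Reduces each identity in \<open>L\<close> to one between module vectors: both sides are
  evaluated at \<open>v\<close>.\<close>

lemma orbit_eqI:
  assumes "x \<in> carrier L" "y \<in> carrier L" "act x v = act y v"
  shows "x = y"
proof -
  have "x \<ominus> y = \<zero>"
    using assms by (intro orbit_inj) (auto simp: act_minus_left)
  then show ?thesis
    using assms by simp
qed

lemmas orbit_simps = act_add_left act_smult_left act_uminus_left act_minus_left act_right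
  act_orbit_prod orbit_prod_closed prod_closed part_carrier
  W.scale_right_distrib W.scale_right_diff_distrib

text \<open>Converse of \<open>act_V\<close> at \<open>v\<close>. The component of the wrong degree
  sends \<open>v\<close> into both parts of \<open>V\<close>, hence to 0, and injectivity of the
  orbit map removes it.\<close>

lemma part_if_act_in:
  assumes x: "x \<in> carrier L" and act: "act x v \<in> V (a + 1)"
  shows "x \<in> part L a"
proof -
  obtain y0 y1 where y: "y0 \<in> part L 0" "y1 \<in> part L 1" "x = y0 \<oplus> y1"
    using part_sum[OF x] by blast
  then have "x = y1 \<oplus> y0"
    by (simp add: M.a_comm part_carrier)
  with y have "\<exists>y \<in> part L a. \<exists>z \<in> part L (a + 1). x = y \<oplus> z"
    by (cases a) fastforce+
  then obtain y z where yz: "y \<in> part L a" "z \<in> part L (a + 1)" "x = y \<oplus> z"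
    by blast
  have "act y v \<in> V (a + 1)" "act z v \<in> V (a + 1 + 1)"
    using yz act_V v_in by blast+
  moreover have "act z v = act x v - act y v"
    using yz by (simp add: orbit_simps)
  ultimately have "act z v \<in> V (a + 1) \<inter> V (a + 1 + 1)"
    using act W.subspace_diff[OF V_subspace] by auto
  then have "act z v = 0"
    using V_Int by (cases a) auto
  then have "z = \<zero>"
    using orbit_inj yz part_carrier by blast
  then show ?thesis
    using yz part_carrier by simp
qed

lemma orbit_prod_part:
  assumes "x \<in> part L a" "y \<in> part L b"
  shows "orbit_prod x y \<in> part L (a + b)"
proof (rule part_if_act_in)
  show "act (orbit_prod x y) v \<in> V (a + b + 1)"
    using act_V[OF assms(1) act_V[OF assms(2) v_in]] assms
    by (simp add: orbit_simps add.assoc)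
qed (use assms in \<open>simp add: orbit_simps\<close>)

theorem lssa_on_orbit_prod: "lssa_on L orbit_prod"
proof -
  let ?P = "L\<lparr>mult := orbit_prod\<rparr>"
  have svs: "super_vector_space ?P"
    by (rule super_vector_space_mult_update) unfold_locales
  have minus: "x \<ominus>\<^bsub>?P\<^esub> y = x \<ominus> y" for x y
    by (simp add: a_minus_def a_inv_def)
  have compat: "orbit_prod x y \<ominus> super_sign a b \<odot> orbit_prod y x = x \<otimes> y"
    if "x \<in> part L a" "y \<in> part L b" for x y a b
    using that by (intro orbit_eqI) (auto simp: orbit_simps act_bracket)
  \<comment> \<open>Skew symmetry and the Jacobi identity come from the representation: after
    evaluation at \<open>v\<close>, repeated use of \<open>act_bracket\<close> leaves only sign
    bookkeeping.\<close>
  have "lie_superalgebra L"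
  proof
    fix x a y b assume xy: "x \<in> part L a" "y \<in> part L b"
    show "x \<otimes> y = \<ominus> (super_sign a b \<odot> (y \<otimes> x))"
      using xy by (intro orbit_eqI) (auto simp: orbit_simps act_bracket super_sign_commute[of b])
    fix z c assume z: "z \<in> part L c"
    show "x \<otimes> (y \<otimes> z) = (x \<otimes> y) \<otimes> z \<oplus> super_sign a b \<odot> (y \<otimes> (x \<otimes> z))"
    proof (rule orbit_eqI)
      note car [simp] = xy[THEN part_carrier] z[THEN part_carrier]
      show "x \<otimes> (y \<otimes> z) \<in> carrier L" "x \<otimes> y \<otimes> z \<oplus> super_sign a b \<odot> (y \<otimes> (x \<otimes> z)) \<in> carrier L"
        by (simp_all add: prod_closed)
      show "act (x \<otimes> (y \<otimes> z)) v = act (x \<otimes> y \<otimes> z \<oplus> super_sign a b \<odot> (y \<otimes> (x \<otimes> z))) v"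
        by (simp add: orbit_simps act_bracket[OF xy(1) prod_part[OF xy(2) z]]
            act_bracket[OF xy(2) prod_part[OF xy(1) z]] act_bracket[OF prod_part[OF xy] z]
            act_bracket[OF xy] act_bracket[OF xy(1) z] act_bracket[OF xy(2) z]
            super_sign_add_left super_sign_add_right super_sign_commute[of b a]
            algebra_simps)
    qed
  qed
  moreover have "superalgebra ?P"
    unfolding superalgebra_def superalgebra_axioms_def
    by (intro conjI svs allI impI; simp add: orbit_prod_closed orbit_prod_part;
      rule orbit_eqI; simp add: orbit_simps)
  moreover have "left_symmetric_superalgebra_axioms ?P"
  proof
    fix x a y b z c
    assume "x \<in> part ?P a" "y \<in> part ?P b" "z \<in> part ?P c"
    then have xyz: "x \<in> part L a" "y \<in> part L b" "z \<in> part L c"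
      by simp_all
    note car = xyz[THEN part_carrier]
    \<comment> \<open>Compatibility was checked at \<open>v\<close> only, but being an identity in
      \<open>L\<close> it may be applied to every \<open>w\<close>. Left symmetry is the instance
      with \<open>w\<close> equal to \<open>act z v\<close>.\<close>
    have act_xy: "act (orbit_prod x y) w = act x (act y w) - sc (super_sign a b) (act y (act x w))
        + sc (super_sign a b) (act (orbit_prod y x) w)" for w
      using arg_cong[OF compat[OF xyz(1,2)], of "\<lambda>u. act u w"] car
      by (simp add: orbit_simps act_bracket[OF xyz(1,2)] algebra_simps)
    have "orbit_prod (orbit_prod x y) z \<ominus> orbit_prod x (orbit_prod y z)
      = super_sign a b \<odot> (orbit_prod (orbit_prod y x) z \<ominus> orbit_prod y (orbit_prod x z))"
      using car by (intro orbit_eqI) (simp_all add: orbit_simps act_xy)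
    then show "x \<otimes>\<^bsub>?P\<^esub> y \<otimes>\<^bsub>?P\<^esub> z \<ominus>\<^bsub>?P\<^esub> x \<otimes>\<^bsub>?P\<^esub> (y \<otimes>\<^bsub>?P\<^esub> z)
      = super_sign a b \<odot>\<^bsub>?P\<^esub> (y \<otimes>\<^bsub>?P\<^esub> x \<otimes>\<^bsub>?P\<^esub> z \<ominus>\<^bsub>?P\<^esub> y \<otimes>\<^bsub>?P\<^esub> (x \<otimes>\<^bsub>?P\<^esub> z))"
      by (simp add: minus)
  qed
  ultimately show ?thesis
    using compat by (simp add: lssa_on_def lssa_on_axioms_def left_symmetric_superalgebra_def)
qed

end

section \<open>Toeplitz and antidiagonal linear systems\<close>

text \<open>The hypotheses say that \<open>B\<close> becomes a symmetric square matrix when a zero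
  column is added on its right, and also when it is added on its left. Together they move an entry
  up and to the right along its antidiagonal until it leaves \<open>B\<close> or reaches row 0,
  which vanishes.\<close>

lemma antidiagonal_symmetric_zero:
  fixes B :: "nat \<Rightarrow> nat \<Rightarrow> 'a::zero"
  assumes B0: "\<And>i j. \<lbrakk>i \<le> m; j \<le> m\<rbrakk> \<Longrightarrow> (if j < m then B i j else 0) = (if i < m then B j i else 0)"
    and B1: "\<And>i j. \<lbrakk>i \<le> m; j \<le> m\<rbrakk> \<Longrightarrow>
      (if 1 \<le> j then B i (j - 1) else 0) = (if 1 \<le> i then B j (i - 1) else 0)"
    and "i \<le> m" "j < m"
  shows "B i j = 0"
  using assms(3,4)
proof (induction i arbitrary: j)
  case 0
  then show ?case
    using B1[of 0 "Suc j"] by simp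
next
  case (Suc i)
  then show ?case
    using B1[of "Suc i" "Suc j"] B0[of "Suc j" i] Suc.IH[of "Suc j"]
    by (auto split: if_splits)
qed

text \<open>The first m columns and the last m columns of \<open>C\<close> both form skew-symmetric
  matrices. Their diagonals give the cases t - s = 0 and t - s = 1; combining the two relations
  moves an entry down and to the left, which lowers t - s by 2.\<close>

lemma antidiagonal_alternating_zero:
  fixes C :: "nat \<Rightarrow> nat \<Rightarrow> 'a::{idom, ring_char_0}"
  assumes C0: "\<And>s t. \<lbrakk>s < m; t < m\<rbrakk> \<Longrightarrow> C s t + C t s = 0"
    and C1: "\<And>s t. \<lbrakk>s < m; t < m\<rbrakk> \<Longrightarrow> C s (Suc t) + C t (Suc s) = 0"
    and st: "s < m" "t \<le> m"
  shows "C s t = 0"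
proof -
  have upper: "C s (s + d) = 0" if "s < m" "s + d \<le> m" for s d
    using that
  proof (induction d arbitrary: s rule: less_induct)
    case (less d)
    consider "d = 0" | "d = 1" | e where "d = Suc (Suc e)"
      by (metis One_nat_def not0_implies_Suc)
    then show ?case
    proof cases
      case 1
      then show ?thesis
        using C0[of s s] less.prems by (simp flip: mult_2)
    next
      case 2
      then show ?thesis
        using C1[of s s] less.prems by (simp flip: mult_2)
    next
      case 3
      have "C s (Suc (Suc (s + e))) = C (Suc s) (Suc (s + e))"
        using C1[of s "Suc (s + e)"] C0[of "Suc (s + e)" "Suc s"] less.prems 3
        by (simp add: add_eq_0_iff)
      also have "\<dots> = 0"
        using less.IH[of e "Suc s"] less.prems 3 by simp
      finally show ?thesis
        using 3 by simp
    qed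
  qed
  show ?thesis
  proof (cases "s \<le> t")
    case True
    then show ?thesis
      using upper[of s "t - s"] st by simp
  next
    case False
    then show ?thesis
      using upper[of t "s - t"] C0[of s t] st by simp
  qed
qed

text \<open>In matrix form the hypotheses are A P + P D^T = 0 and A Q + Q D^T = 0. Eliminating D
  makes A constant along diagonals; the zero row of Q clears row 0 to the right of the diagonal, and
  the zero row of P clears row m to the left of it. This leaves A = a I and D = -a I, and the trace
  condition reads (2m+1) a = 0.\<close>

lemma toeplitz_traceless_zero:
  fixes A D :: "nat \<Rightarrow> nat \<Rightarrow> 'a::{idom, ring_char_0}"
  assumes A0: "\<And>i t. \<lbrakk>i \<le> m; t < m\<rbrakk> \<Longrightarrow> A i t + (if i < m then D t i else 0) = 0"
    and A1: "\<And>i t. \<lbrakk>i \<le> m; t < m\<rbrakk> \<Longrightarrow> A i (Suc t) + (if 1 \<le> i then D t (i - 1) else 0) = 0"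
    and tr: "(\<Sum>i<Suc m. A i i) = (\<Sum>t<m. D t t)"
  shows "\<lbrakk>i \<le> m; j \<le> m\<rbrakk> \<Longrightarrow> A i j = 0" and "\<lbrakk>s < m; t < m\<rbrakk> \<Longrightarrow> D s t = 0"
proof -
  have shift: "A (Suc i) (Suc t) = A i t" if "i < m" "t < m" for i t
  proof -
    have "A i t + D t i = 0" "A (Suc i) (Suc t) + D t i = 0"
      using A0[of i t] A1[of "Suc i" t] that by simp_all
    then show ?thesis
      by (metis add_right_cancel)
  qed
  have upper: "A i j = 0" if "i < j" "j \<le> m" for i j
    using that
  proof (induction i arbitrary: j)
    case 0
    then show ?case
      using A1[of 0 "j - 1"] by simp
  next
    case (Suc i)
    then obtain j' where "j = Suc j'"
      by (metis less_imp_Suc_add)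
    then show ?case
      using Suc shift[of i j'] by simp
  qed
  have lower: "A i j = 0" if "j < i" "i \<le> m" for i j
  proof -
    have "\<forall>j<i. A i j = 0"
      using \<open>i \<le> m\<close>
    proof (induction i rule: inc_induct)
      case base
      then show ?case
        using A0[of m] by simp
    next
      case (step i)
      then show ?case
        using shift by (metis Suc_less_eq less_trans)
    qed
    then show ?thesis
      using that by simp
  qed
  have diag: "A i i = A 0 0" if "i \<le> m" for i
    using that by (induction i) (auto simp: shift)
  have D: "D t i = - A i t" if "i < m" "t < m" for i t
    using A0[of i t] that by (simp add: add_eq_0_iff)
  have "(\<Sum>i<Suc m. A i i) = (\<Sum>i<Suc m. A 0 0)"
    by (intro sum.cong refl) (metis diag lessThan_Suc_atMost atMost_iff)
  moreover have "(\<Sum>t<m. D t t) = (\<Sum>t<m. - A 0 0)"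
    by (intro sum.cong refl) (metis D diag lessThan_iff less_imp_le)
  ultimately have "of_nat (Suc m + m) * A 0 0 = 0"
    using tr by (simp add: algebra_simps)
  then have A00: "A 0 0 = 0"
    by (simp only: mult_eq_0_iff of_nat_eq_0_iff) simp
  have A: "A i j = 0" if "i \<le> m" "j \<le> m" for i j
    using A00 upper[of i j] lower[of j i] diag[of i] that by (cases i j rule: linorder_cases) auto
  show "\<lbrakk>i \<le> m; j \<le> m\<rbrakk> \<Longrightarrow> A i j = 0" and "\<lbrakk>s < m; t < m\<rbrakk> \<Longrightarrow> D s t = 0"
    using A D by simp_all
qed

section \<open>The superalgebra sl(p|q)\<close>

definition deg :: "nat \<Rightarrow> nat \<Rightarrow> bit" where
  "deg p i = (if i < p then 0 else 1)"

lemma bit_add_simps [simp]: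
  fixes a b :: bit
  shows "a + a = 0" "a + (a + b) = b" "b + a + a = b"
  by (cases a; cases b; simp)+

lemma bit_add_eq_iff:
  fixes a b c :: bit
  shows "a + b = c \<longleftrightarrow> b = a + c"
  by (cases a; cases b; cases c; simp)

lemma supertrace_eq:
  assumes "X \<in> carrier_mat (p + q) (p + q)"
  shows "supertrace p X = (\<Sum>i<p. X $$ (i, i)) - (\<Sum>i<q. X $$ (p + i, p + i))"
  using assms by (simp add: supertrace_def split_block_def Let_def mat_trace_def add.commute)

text \<open>One signed sum over all indices, so that the double sums in the supertrace of a bracket
  can be swapped without splitting into blocks.\<close>

lemma supertrace_eq_sum_deg:
  assumes "X \<in> carrier_mat (p + q) (p + q)"
  shows "supertrace p X = (\<Sum>i<p + q. super_sign 1 (deg p i) * X $$ (i, i))"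
proof -
  have split: "{..<p + q} = {..<p} \<union> (\<lambda>i. p + i) ` {..<q}"
  proof (rule Set.set_eqI)
    show "x \<in> {..<p + q} \<longleftrightarrow> x \<in> {..<p} \<union> (\<lambda>i. p + i) ` {..<q}" for x
      by (cases "x < p") (auto simp: image_iff intro: bexI[of _ "x - p"])
  qed
  have "(\<Sum>i<p + q. super_sign 1 (deg p i) * X $$ (i, i)) =
      (\<Sum>i<p. X $$ (i, i)) + (\<Sum>i<q. - X $$ (p + i, p + i))"
    unfolding split by (subst sum.union_disjoint) (auto simp: sum.reindex deg_def)
  then show ?thesis
    using assms by (simp add: supertrace_eq sum_negf)
qed

text \<open>The matrix unit at (i, j) has degree \<open>deg p i + deg p j\<close>; this entrywise
  form replaces the blocks in all later parity arguments.\<close>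

lemma gl_part_iff:
  "X \<in> gl_part p q a \<longleftrightarrow> X \<in> carrier_mat (p + q) (p + q) \<and>
    (\<forall>i<p + q. \<forall>j<p + q. deg p i + deg p j \<noteq> a \<longrightarrow> X $$ (i, j) = 0)"
proof (cases "X \<in> carrier_mat (p + q) (p + q)")
  case True
  have all: "(\<forall>i<p + q. P i) \<longleftrightarrow> (\<forall>i<p. P i) \<and> (\<forall>i<q. P (i + p))" for P
  proof safe
    fix i
    assume "\<forall>i<p. P i" "\<forall>i<q. P (i + p)" "i < p + q"
    then show "P i"
      using spec[of "\<lambda>i. i < q \<longrightarrow> P (i + p)" "i - p"] by (cases "i < p") auto
  qed auto
  show ?thesis
    using True unfolding all
    by (cases a) (auto simp: gl_part_def split_block_def Let_def mat_eq_iff deg_def)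
qed (auto simp: gl_part_def)

lemma gl_part_carrier: "X \<in> gl_part p q a \<Longrightarrow> X \<in> carrier_mat (p + q) (p + q)"
  by (simp add: gl_part_iff)

section \<open>The bracket in matrix entries\<close>

lemma gl_component_carrier [simp]:
  "X \<in> carrier_mat (p + q) (p + q) \<Longrightarrow> gl_component p q a X \<in> carrier_mat (p + q) (p + q)"
  by (auto simp: gl_component_def split_block_def Let_def)

lemma gl_component_index:
  assumes "X \<in> carrier_mat (p + q) (p + q)" "i < p + q" "j < p + q"
  shows "gl_component p q a X $$ (i, j) = (if deg p i + deg p j = a then X $$ (i, j) else 0)"
  using assms by (cases a) (auto simp: gl_component_def split_block_def Let_def deg_def)

lemma gl_bracket_carrier:
  assumes "X \<in> carrier_mat (p + q) (p + q)" "Y \<in> carrier_mat (p + q) (p + q)"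
  shows "gl_bracket p q X Y \<in> carrier_mat (p + q) (p + q)"
  using gl_component_carrier[OF assms(1)] gl_component_carrier[OF assms(2)]
  unfolding gl_bracket_def Let_def
  by (meson add_carrier_mat minus_carrier_mat mult_carrier_mat smult_carrier_mat)

text \<open>Each entry survives in exactly one homogeneous component, so the four brackets merge
  into one sum whose sign is read off from the degrees of the two entries being exchanged.\<close>

lemma gl_bracket_index:
  assumes X: "X \<in> carrier_mat (p + q) (p + q)" and Y: "Y \<in> carrier_mat (p + q) (p + q)"
    and ij: "i < p + q" "j < p + q"
  shows "gl_bracket p q X Y $$ (i, j) = (\<Sum>l<p + q. X $$ (i, l) * Y $$ (l, j) -
    super_sign (deg p i + deg p l) (deg p l + deg p j) * (Y $$ (i, l) * X $$ (l, j)))"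
proof -
  let ?c = "gl_component p q"
  have br: "(?c a X * ?c b Y - super_sign a b \<cdot>\<^sub>m (?c b Y * ?c a X)) $$ (i, j) =
      (\<Sum>l<p + q. ?c a X $$ (i, l) * ?c b Y $$ (l, j) - super_sign a b * (?c b Y $$ (i, l) * ?c a X $$ (l, j)))"
    for a b
    using gl_component_carrier[OF X, of a] gl_component_carrier[OF Y, of b] ij
    by (simp add: scalar_prod_def sum_subtractf sum_distrib_left atLeast0LessThan)
  have car: "?c a X * ?c b Y - super_sign a b \<cdot>\<^sub>m (?c b Y * ?c a X) \<in> carrier_mat (p + q) (p + q)" for a b
    using gl_component_carrier[OF X, of a] gl_component_carrier[OF Y, of b] by auto
  have "gl_bracket p q X Y $$ (i, j) =
      (\<Sum>l<p + q. ?c 0 X $$ (i, l) * ?c 0 Y $$ (l, j) - super_sign 0 0 * (?c 0 Y $$ (i, l) * ?c 0 X $$ (l, j))) +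
      (\<Sum>l<p + q. ?c 0 X $$ (i, l) * ?c 1 Y $$ (l, j) - super_sign 0 1 * (?c 1 Y $$ (i, l) * ?c 0 X $$ (l, j))) +
      (\<Sum>l<p + q. ?c 1 X $$ (i, l) * ?c 0 Y $$ (l, j) - super_sign 1 0 * (?c 0 Y $$ (i, l) * ?c 1 X $$ (l, j))) +
      (\<Sum>l<p + q. ?c 1 X $$ (i, l) * ?c 1 Y $$ (l, j) - super_sign 1 1 * (?c 1 Y $$ (i, l) * ?c 1 X $$ (l, j)))"
    unfolding gl_bracket_def Let_def br[symmetric]
    using car[of 0 0] car[of 0 1] car[of 1 0] car[of 1 1] ij
    by (simp only: index_add_mat carrier_matD add_carrier_mat)
  also have "\<dots> = (\<Sum>l<p + q. X $$ (i, l) * Y $$ (l, j) -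
    super_sign (deg p i + deg p l) (deg p l + deg p j) * (Y $$ (i, l) * X $$ (l, j)))"
    unfolding sum.distrib[symmetric]
  proof (rule sum.cong)
    fix l assume "l \<in> {..<p + q}"
    then show "?c 0 X $$ (i, l) * ?c 0 Y $$ (l, j) - super_sign 0 0 * (?c 0 Y $$ (i, l) * ?c 0 X $$ (l, j)) +
      (?c 0 X $$ (i, l) * ?c 1 Y $$ (l, j) - super_sign 0 1 * (?c 1 Y $$ (i, l) * ?c 0 X $$ (l, j))) +
      (?c 1 X $$ (i, l) * ?c 0 Y $$ (l, j) - super_sign 1 0 * (?c 0 Y $$ (i, l) * ?c 1 X $$ (l, j))) +
      (?c 1 X $$ (i, l) * ?c 1 Y $$ (l, j) - super_sign 1 1 * (?c 1 Y $$ (i, l) * ?c 1 X $$ (l, j))) =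
      X $$ (i, l) * Y $$ (l, j) -
      super_sign (deg p i + deg p l) (deg p l + deg p j) * (Y $$ (i, l) * X $$ (l, j))"
      using ij by (simp only: gl_component_index[OF X] gl_component_index[OF Y] lessThan_iff)
        (auto simp: deg_def)
  qed simp
  finally show ?thesis .
qed

lemma gl_bracket_index_part:
  assumes X: "X \<in> gl_part p q a" and Y: "Y \<in> gl_part p q b" and ij: "i < p + q" "j < p + q"
  shows "gl_bracket p q X Y $$ (i, j) =
    (\<Sum>l<p + q. X $$ (i, l) * Y $$ (l, j)) - super_sign a b * (\<Sum>l<p + q. Y $$ (i, l) * X $$ (l, j))"
proof -
  have "super_sign (deg p i + deg p l) (deg p l + deg p j) * (Y $$ (i, l) * X $$ (l, j)) =
      super_sign a b * (Y $$ (i, l) * X $$ (l, j))" if "l < p + q" for l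
  proof (cases "Y $$ (i, l) = 0 \<or> X $$ (l, j) = 0")
    case False
    then have "deg p i + deg p l = b" "deg p l + deg p j = a"
      using X Y ij that unfolding gl_part_iff by blast+
    then show ?thesis
      by (simp add: super_sign_commute)
  qed auto
  then have "(\<Sum>l<p + q. super_sign (deg p i + deg p l) (deg p l + deg p j) * (Y $$ (i, l) * X $$ (l, j))) =
      super_sign a b * (\<Sum>l<p + q. Y $$ (i, l) * X $$ (l, j))"
    unfolding sum_distrib_left by (intro sum.cong refl) simp
  then show ?thesis
    using X Y ij by (simp add: gl_bracket_index gl_part_iff sum_subtractf)
qed

lemma gl_bracket_bilinear:
  assumes X: "X \<in> carrier_mat (p + q) (p + q)" and Y: "Y \<in> carrier_mat (p + q) (p + q)"
    and Z: "Z \<in> carrier_mat (p + q) (p + q)"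
  shows gl_bracket_add_left: "gl_bracket p q (X + Y) Z = gl_bracket p q X Z + gl_bracket p q Y Z"
    and gl_bracket_add_right: "gl_bracket p q Z (X + Y) = gl_bracket p q Z X + gl_bracket p q Z Y"
    and gl_bracket_smult_left: "gl_bracket p q (c \<cdot>\<^sub>m X) Y = c \<cdot>\<^sub>m gl_bracket p q X Y"
    and gl_bracket_smult_right: "gl_bracket p q X (c \<cdot>\<^sub>m Y) = c \<cdot>\<^sub>m gl_bracket p q X Y"
proof -
  have dim: "dim_row (gl_bracket p q U W) = p + q" "dim_col (gl_bracket p q U W) = p + q"
    if "U \<in> carrier_mat (p + q) (p + q)" "W \<in> carrier_mat (p + q) (p + q)" for U W
    using gl_bracket_carrier[OF that] by auto
  note simps = dim gl_bracket_index carrier_matD[OF X] carrier_matD[OF Y] sum_distrib_left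
  show "gl_bracket p q (X + Y) Z = gl_bracket p q X Z + gl_bracket p q Y Z"
    by (rule eq_matI) (use X Y Z in \<open>auto simp: simps algebra_simps sum.distrib[symmetric] intro!: sum.cong\<close>)
  show "gl_bracket p q Z (X + Y) = gl_bracket p q Z X + gl_bracket p q Z Y"
    by (rule eq_matI) (use X Y Z in \<open>auto simp: simps algebra_simps sum.distrib[symmetric] intro!: sum.cong\<close>)
  show "gl_bracket p q (c \<cdot>\<^sub>m X) Y = c \<cdot>\<^sub>m gl_bracket p q X Y"
    by (rule eq_matI) (use X Y Z in \<open>auto simp: simps algebra_simps intro!: sum.cong\<close>)
  show "gl_bracket p q X (c \<cdot>\<^sub>m Y) = c \<cdot>\<^sub>m gl_bracket p q X Y"
    by (rule eq_matI) (use X Y Z in \<open>auto simp: simps algebra_simps intro!: sum.cong\<close>)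
qed

lemma supertrace_gl_bracket:
  assumes X: "X \<in> carrier_mat (p + q) (p + q)" and Y: "Y \<in> carrier_mat (p + q) (p + q)"
  shows "supertrace p (gl_bracket p q X Y) = 0"
proof -
  let ?s = "\<lambda>i. super_sign 1 (deg p i)"
  \<comment> \<open>For equal arguments d the sign is (-1)^d, here with d = deg i + deg l. It turns
    the sign of row i into that of row l, so the summand becomes antisymmetric in i and l.\<close>
  have sign: "?s i * super_sign (deg p i + deg p l) (deg p l + deg p i) = ?s l" for i l
    by (auto simp: deg_def)
  have summand: "?s i * (X $$ (i, l) * Y $$ (l, i) -
      super_sign (deg p i + deg p l) (deg p l + deg p i) * (Y $$ (i, l) * X $$ (l, i))) =
      ?s i * (X $$ (i, l) * Y $$ (l, i)) - ?s l * (X $$ (l, i) * Y $$ (i, l))" for i l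
    unfolding sign[of i l, symmetric] by (simp add: algebra_simps)
  have "supertrace p (gl_bracket p q X Y) =
      (\<Sum>i<p + q. \<Sum>l<p + q. ?s i * (X $$ (i, l) * Y $$ (l, i)) - ?s l * (X $$ (l, i) * Y $$ (i, l)))"
    using X Y unfolding supertrace_eq_sum_deg[OF gl_bracket_carrier[OF X Y]]
    by (simp add: gl_bracket_index sum_distrib_left summand)
  also have "\<dots> = 0"
    unfolding sum_subtractf by (subst (2) sum.swap) simp
  finally show ?thesis .
qed

lemma gl_bracket_part:
  assumes X: "X \<in> gl_part p q a" and Y: "Y \<in> gl_part p q b"
  shows "gl_bracket p q X Y \<in> gl_part p q (a + b)"
  unfolding gl_part_iff
proof (intro conjI allI impI)
  fix i j assume ij: "i < p + q" "j < p + q" and deg: "deg p i + deg p j \<noteq> a + b"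
  have "X $$ (i, l) * Y $$ (l, j) = 0" "Y $$ (i, l) * X $$ (l, j) = 0" if "l < p + q" for l
  proof -
    have "\<not> (deg p i + deg p l = a \<and> deg p l + deg p j = b)"
      "\<not> (deg p i + deg p l = b \<and> deg p l + deg p j = a)"
      using deg by (auto simp: deg_def)
    then show "X $$ (i, l) * Y $$ (l, j) = 0" "Y $$ (i, l) * X $$ (l, j) = 0"
      using X Y ij that unfolding gl_part_iff by (metis mult_eq_0_iff)+
  qed
  then have "(\<Sum>l<p + q. X $$ (i, l) * Y $$ (l, j)) = 0" "(\<Sum>l<p + q. Y $$ (i, l) * X $$ (l, j)) = 0"
    by (auto intro!: sum.neutral simp del: mult_eq_0_iff)
  then show "gl_bracket p q X Y $$ (i, j) = 0"
    using gl_bracket_index_part[OF X Y ij] by simp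
qed (use X Y in \<open>simp add: gl_bracket_carrier gl_part_iff\<close>)

lemma sl_super_simps [simp]:
  "carrier (sl_super p q) = {X \<in> carrier_mat (p + q) (p + q). supertrace p X = 0}"
  "mult (sl_super p q) = gl_bracket p q"
  "zero (sl_super p q) = 0\<^sub>m (p + q) (p + q)"
  "add (sl_super p q) = (+)"
  "module.smult (sl_super p q) = (\<cdot>\<^sub>m)"
  "part (sl_super p q) a = {X \<in> gl_part p q a. supertrace p X = 0}"
  by (simp_all add: sl_super_def gl_super_def)

lemma supertrace_simps [simp]:
  assumes "X \<in> carrier_mat (p + q) (p + q)" "Y \<in> carrier_mat (p + q) (p + q)"
  shows "supertrace p (X + Y) = supertrace p X + supertrace p Y"
    and "supertrace p (c \<cdot>\<^sub>m X) = c * supertrace p X"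
    and "supertrace p (0\<^sub>m (p + q) (p + q)) = 0"
  using assms by (simp_all add: supertrace_eq[of _ p q] sum.distrib sum_distrib_left algebra_simps)

lemma superalgebra_sl_super: "superalgebra (sl_super p q)"
proof -
  let ?L = "sl_super p q" and ?M = "carrier_mat (p + q) (p + q) :: complex mat set"
  have tr: "supertrace p (- X) = 0" if "X \<in> ?M" "supertrace p X = 0" for X
    using that by (simp add: supertrace_eq[of _ p q] sum_negf)
  have ag: "abelian_group ?L"
  proof (rule abelian_groupI)
    fix X assume "X \<in> carrier ?L"
    then show "\<exists>Y\<in>carrier ?L. Y \<oplus>\<^bsub>?L\<^esub> X = \<zero>\<^bsub>?L\<^esub>"
      using tr by (intro bexI[of _ "- X"]) auto
  qed (auto simp: supertrace_simps[of _ p q] supertrace_eq[of "0\<^sub>m (p + q) (p + q)" p q] intro: comm_add_mat)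
  have md: "Module.module (class_ring :: complex ring) ?L"
    by (rule moduleI[OF class_cring.is_cring ag])
      (auto simp: supertrace_simps[of _ p q] add_smult_distrib_right_mat add_smult_distrib_left_mat
         intro!: eq_matI simp: algebra_simps)
  have sub: "LinearCombinations.submodule class_ring (part ?L a) ?L" for a
    using md unfolding submodule_def
    by (auto simp: gl_part_iff supertrace_simps[of _ p q] supertrace_eq[of "0\<^sub>m (p + q) (p + q)" p q])
  have sum: "\<exists>Y \<in> part ?L 0. \<exists>Z \<in> part ?L 1. X = Y \<oplus>\<^bsub>?L\<^esub> Z" if "X \<in> carrier ?L" for X
  proof (intro bexI)
    from that have X: "X \<in> ?M" "supertrace p X = 0"
      by simp_all
    have c: "gl_component p q a X \<in> ?M" for a
      using X by simp
    show "X = gl_component p q 0 X \<oplus>\<^bsub>?L\<^esub> gl_component p q 1 X"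
      using X c[of 0] c[of 1]
      by (intro eq_matI) (auto simp: gl_component_index carrier_matD[OF c] carrier_matD[OF X(1)])
    have "gl_component p q a X \<in> gl_part p q a" for a
      using X c[of a] by (auto simp: gl_part_iff gl_component_index)
    \<comment> \<open>The whole diagonal has degree 0, so the even component keeps the supertrace
      and the odd one has none.\<close>
    moreover have "supertrace p (gl_component p q 0 X) = supertrace p X"
      "supertrace p (gl_component p q 1 X) = 0"
      using X unfolding supertrace_eq_sum_deg[OF c] supertrace_eq_sum_deg[OF X(1)]
      by (simp_all add: gl_component_index)
    ultimately show "gl_component p q 0 X \<in> part ?L 0" "gl_component p q 1 X \<in> part ?L 1"
      using X by simp_all
  qed
  have int: "part ?L 0 \<inter> part ?L 1 = {\<zero>\<^bsub>?L\<^esub>}"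
  proof -
    have "X = 0\<^sub>m (p + q) (p + q)" if "X \<in> gl_part p q 0" "X \<in> gl_part p q 1" for X
      using that unfolding gl_part_iff by (intro eq_matI) (auto, metis bit_not_zero_iff)
    then show ?thesis
      by (auto simp: gl_part_iff supertrace_simps[of _ p q] supertrace_eq[of "0\<^sub>m (p + q) (p + q)" p q])
  qed
  have "super_vector_space ?L"
    using md sub sum int
    by (simp add: super_vector_space_def super_vector_space_axioms_def vectorspace_def class_field.field_axioms)
  moreover have "superalgebra_axioms ?L"
    unfolding superalgebra_axioms_def sl_super_simps
    by (auto simp: gl_bracket_carrier supertrace_gl_bracket gl_bracket_part gl_bracket_bilinear
        supertrace_gl_bracket[OF gl_part_carrier gl_part_carrier] dest: gl_part_carrier)
  ultimately show ?thesis
    by (simp add: superalgebra_def)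
qed

section \<open>The super exterior square\<close>

definition fun_scale :: "complex \<Rightarrow> ('i \<Rightarrow> complex) \<Rightarrow> 'i \<Rightarrow> complex" where
  "fun_scale c w = (\<lambda>i. c * w i)"

interpretation fun_vs: vector_space fun_scale
  by unfold_locales (auto simp: fun_scale_def fun_eq_iff algebra_simps)

text \<open>Supplies the finite spanning set for the dimension count, since the space of all
  functions is infinite-dimensional.\<close>

lemma finite_support_in_span:
  assumes "finite F" "\<And>i. i \<notin> F \<Longrightarrow> w i = 0"
  shows "w \<in> fun_vs.span ((\<lambda>i j. if j = i then 1 else 0) ` F)"
proof -
  have 1: "w j = (\<Sum>i\<in>F. w i * (if j = i then 1 else 0))" for j
    using assms(1) assms(2)[of j] by (simp add: if_distrib[of "(*) _"] cong: if_cong)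
  have 2: "(\<Sum>i\<in>F. fun_scale (w i) (\<lambda>j. if j = i then 1 else 0)) j =
      (\<Sum>i\<in>F. w i * (if j = i then 1 else 0))" for j
    using assms(1) by (induction F) (simp_all add: fun_scale_def)
  have "w = (\<Sum>i\<in>F. fun_scale (w i) (\<lambda>j. if j = i then 1 else 0))"
    by (rule ext, rule trans[OF 1 2[symmetric]])
  also have "\<dots> \<in> fun_vs.span ((\<lambda>i j. if j = i then 1 else 0) ` F)"
    by (intro fun_vs.span_sum fun_vs.span_scale fun_vs.span_base) simp
  finally show ?thesis .
qed

text \<open>Two copies (indexed by the first component \<open>k\<close>) of the tensor square of the natural module. The
  sign in the second sum comes from moving the odd part of \<open>X\<close> past the \<open>i\<close>-th basis vector.\<close>

definition tensor_act :: "nat \<Rightarrow> nat \<Rightarrow> complex mat \<Rightarrow> (nat \<times> nat \<times> nat \<Rightarrow> complex)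
    \<Rightarrow> nat \<times> nat \<times> nat \<Rightarrow> complex" where
  "tensor_act p q X w = (\<lambda>(k, i, j). if i < p + q \<and> j < p + q
     then (\<Sum>l<p + q. X $$ (i, l) * w (k, l, j)) +
       (\<Sum>l<p + q. super_sign (deg p i) (deg p j + deg p l) * (w (k, i, l) * X $$ (j, l)))
     else 0)"

text \<open>Two copies of the super exterior square: alternating on even and symmetric on odd indices.\<close>

definition alt_pairs :: "nat \<Rightarrow> nat \<Rightarrow> (nat \<times> nat \<times> nat \<Rightarrow> complex) set" where
  "alt_pairs p q = {w. (\<forall>k i j. \<not> (k < 2 \<and> i < p + q \<and> j < p + q) \<longrightarrow> w (k, i, j) = 0) \<and>
     (\<forall>k i j. w (k, j, i) = - super_sign (deg p i) (deg p j) * w (k, i, j))}"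

definition alt_pairs_part :: "nat \<Rightarrow> nat \<Rightarrow> bit \<Rightarrow> (nat \<times> nat \<times> nat \<Rightarrow> complex) set" where
  "alt_pairs_part p q a = {w \<in> alt_pairs p q. \<forall>k i j. deg p i + deg p j \<noteq> a \<longrightarrow> w (k, i, j) = 0}"

section \<open>The representation on the tensor square\<close>

lemma tensor_act_add_left:
  assumes "X \<in> carrier_mat (p + q) (p + q)" "Y \<in> carrier_mat (p + q) (p + q)"
  shows "tensor_act p q (X + Y) w = tensor_act p q X w + tensor_act p q Y w"
  using assms by (auto simp: tensor_act_def fun_eq_iff sum.distrib algebra_simps)

lemma tensor_act_smult_left:
  assumes "X \<in> carrier_mat (p + q) (p + q)"
  shows "tensor_act p q (c \<cdot>\<^sub>m X) w = fun_scale c (tensor_act p q X w)"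
  using assms by (auto simp: tensor_act_def fun_scale_def fun_eq_iff algebra_simps sum_distrib_left)

lemma tensor_act_add_right: "tensor_act p q X (w + w') = tensor_act p q X w + tensor_act p q X w'"
  by (auto simp: tensor_act_def fun_eq_iff sum.distrib algebra_simps)

lemma tensor_act_scale_right: "tensor_act p q X (fun_scale c w) = fun_scale c (tensor_act p q X w)"
  by (auto simp: tensor_act_def fun_scale_def fun_eq_iff sum_distrib_left algebra_simps)

lemma tensor_act_part:
  assumes "X \<in> gl_part p q a" "i < p + q" "j < p + q"
  shows "tensor_act p q X w (k, i, j) = (\<Sum>l<p + q. X $$ (i, l) * w (k, l, j)) +
    super_sign (deg p i) a * (\<Sum>l<p + q. w (k, i, l) * X $$ (j, l))"
proof -
  have "super_sign (deg p i) (deg p j + deg p l) * (w (k, i, l) * X $$ (j, l)) =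
    super_sign (deg p i) a * (w (k, i, l) * X $$ (j, l))" if "l < p + q" for l
    using assms that by (cases "X $$ (j, l) = 0") (auto simp: gl_part_iff)
  then have "(\<Sum>l<p + q. super_sign (deg p i) (deg p j + deg p l) * (w (k, i, l) * X $$ (j, l))) =
      super_sign (deg p i) a * (\<Sum>l<p + q. w (k, i, l) * X $$ (j, l))"
    unfolding sum_distrib_left by (intro sum.cong refl) simp
  then show ?thesis
    using assms by (simp add: tensor_act_def)
qed

lemma tensor_act_bracket:
  assumes X: "X \<in> gl_part p q a" and Y: "Y \<in> gl_part p q b"
  shows "tensor_act p q (gl_bracket p q X Y) w =
    tensor_act p q X (tensor_act p q Y w) -
    fun_scale (super_sign a b) (tensor_act p q Y (tensor_act p q X w))"
proof (rule ext, clarify)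
  fix k i j
  let ?N = "{..<p + q}" and ?act = "tensor_act p q" and ?s = "super_sign a b"
  show "?act (gl_bracket p q X Y) w (k, i, j) =
    (?act X (?act Y w) - fun_scale ?s (?act Y (?act X w))) (k, i, j)"
  proof (cases "i < p + q \<and> j < p + q")
    case True
    then have ij: "i < p + q" "j < p + q"
      by simp_all
    \<comment> \<open>\<open>T\<close> collects the terms where both matrices act on the first
      factor, \<open>R\<close> those where both act on the second, and \<open>U\<close> the mixed
      terms. The mixed terms cancel in the supercommutator.\<close>
    define T where "T X Y = (\<Sum>l\<in>?N. (\<Sum>r\<in>?N. X $$ (i, r) * Y $$ (r, l)) * w (k, l, j))" for X Y
    define U where "U X Y = (\<Sum>l\<in>?N. \<Sum>r\<in>?N. X $$ (i, l) * w (k, l, r) * Y $$ (j, r))" for X Y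
    define R where "R X Y = (\<Sum>l\<in>?N. w (k, i, l) * (\<Sum>r\<in>?N. X $$ (j, r) * Y $$ (r, l)))" for X Y
    have comp: "?act X (?act Y w) (k, i, j) = T X Y + super_sign a b * super_sign (deg p i) b * U X Y
        + super_sign (deg p i) a * U Y X + super_sign (deg p i) (a + b) * R X Y"
      if X: "X \<in> gl_part p q a" and Y: "Y \<in> gl_part p q b" for X Y a b
    proof -
      \<comment> \<open>A nonzero entry of \<open>X\<close> changes the degree of the first index by
        \<open>a\<close>; passing \<open>Y\<close> across the changed index costs the extra factor
        \<open>super_sign a b\<close>.\<close>
      have sign: "X $$ (i, l) * (super_sign (deg p l) b * z) =
          super_sign a b * super_sign (deg p i) b * (X $$ (i, l) * z)" if "l < p + q" for l z
      proof (cases "X $$ (i, l) = 0")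
        case False
        then have "deg p i + deg p l = a"
          using X ij that by (auto simp: gl_part_iff)
        then have "deg p l = deg p i + a"
          by (simp add: bit_add_eq_iff)
        then show ?thesis
          by (simp add: super_sign_add_left mult_ac)
      qed simp
      have 1: "(\<Sum>l\<in>?N. X $$ (i, l) * (\<Sum>r\<in>?N. Y $$ (l, r) * w (k, r, j))) = T X Y"
        unfolding T_def sum_distrib_left sum_distrib_right
        by (subst sum.swap) (simp add: mult_ac)
      have 2: "(\<Sum>l\<in>?N. X $$ (i, l) * (super_sign (deg p l) b * (\<Sum>r\<in>?N. w (k, l, r) * Y $$ (j, r)))) =
          super_sign a b * super_sign (deg p i) b * U X Y"
      proof -
        have "(\<Sum>l\<in>?N. X $$ (i, l) * (super_sign (deg p l) b * (\<Sum>r\<in>?N. w (k, l, r) * Y $$ (j, r)))) =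
          (\<Sum>l\<in>?N. super_sign a b * super_sign (deg p i) b *
            (X $$ (i, l) * (\<Sum>r\<in>?N. w (k, l, r) * Y $$ (j, r))))"
          by (intro sum.cong refl sign) simp
        then show ?thesis
          unfolding U_def by (simp add: sum_distrib_left mult_ac)
      qed
      have 3: "(\<Sum>l\<in>?N. (\<Sum>r\<in>?N. Y $$ (i, r) * w (k, r, l)) * X $$ (j, l)) = U Y X"
        unfolding U_def sum_distrib_right by (subst sum.swap) simp
      have 4: "(\<Sum>l\<in>?N. (super_sign (deg p i) b * (\<Sum>r\<in>?N. w (k, i, r) * Y $$ (l, r))) * X $$ (j, l)) =
          super_sign (deg p i) b * R X Y"
        unfolding R_def sum_distrib_left sum_distrib_right
        by (subst sum.swap) (simp add: mult_ac)
      have "?act X (?act Y w) (k, i, j) =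
          (\<Sum>l\<in>?N. X $$ (i, l) * ((\<Sum>r\<in>?N. Y $$ (l, r) * w (k, r, j)) +
            super_sign (deg p l) b * (\<Sum>r\<in>?N. w (k, l, r) * Y $$ (j, r)))) +
          super_sign (deg p i) a * (\<Sum>l\<in>?N. ((\<Sum>r\<in>?N. Y $$ (i, r) * w (k, r, l)) +
            super_sign (deg p i) b * (\<Sum>r\<in>?N. w (k, i, r) * Y $$ (l, r))) * X $$ (j, l))"
        using ij by (simp add: tensor_act_part[OF X] tensor_act_part[OF Y])
      also have "\<dots> = T X Y + super_sign a b * super_sign (deg p i) b * U X Y
        + super_sign (deg p i) a * (U Y X + super_sign (deg p i) b * R X Y)"
        unfolding distrib_left distrib_right sum.distrib 1 2 3 4 by (simp add: distrib_left)
      finally show ?thesis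
        by (simp add: super_sign_add_right algebra_simps)
    qed
    have "?act (gl_bracket p q X Y) w (k, i, j) =
        (T X Y - ?s * T Y X) + super_sign (deg p i) (a + b) * (R X Y - ?s * R Y X)"
      using ij unfolding T_def R_def
      by (simp add: tensor_act_part[OF gl_bracket_part[OF X Y]] gl_bracket_index_part[OF X Y]
          left_diff_distrib right_diff_distrib sum_subtractf sum_distrib_left mult_ac)
    then show ?thesis
      by (simp add: comp[OF X Y] comp[OF Y X] fun_scale_def super_sign_commute[of b a]
          algebra_simps)
  qed (auto simp: tensor_act_def fun_scale_def)
qed

section \<open>The super exterior square as a graded submodule\<close>

lemma alt_pairs_swap:
  "w \<in> alt_pairs p q \<Longrightarrow> w (k, j, i) = - super_sign (deg p i) (deg p j) * w (k, i, j)"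
  unfolding alt_pairs_def by blast

lemma alt_pairs_outside:
  "\<lbrakk>w \<in> alt_pairs p q; \<not> (k < 2 \<and> i < p + q \<and> j < p + q)\<rbrakk> \<Longrightarrow> w (k, i, j) = 0"
  unfolding alt_pairs_def by blast

lemma alt_pairsI:
  assumes "\<And>k i j. \<not> (k < 2 \<and> i < p + q \<and> j < p + q) \<Longrightarrow> w (k, i, j) = 0"
    and "\<And>k i j. \<lbrakk>k < 2; i < p + q; j < p + q\<rbrakk> \<Longrightarrow>
      w (k, j, i) = - super_sign (deg p i) (deg p j) * w (k, i, j)"
  shows "w \<in> alt_pairs p q"
  unfolding alt_pairs_def mem_Collect_eq
proof (intro conjI allI impI)
  fix k i j
  show "w (k, j, i) = - super_sign (deg p i) (deg p j) * w (k, i, j)"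
  proof (cases "k < 2 \<and> i < p + q \<and> j < p + q")
    case False
    then have "w (k, i, j) = 0" "w (k, j, i) = 0"
      using assms(1) by blast+
    then show ?thesis
      by simp
  qed (use assms(2) in blast)
qed (fact assms(1))

lemma subspace_alt_pairs: "fun_vs.subspace (alt_pairs p q)"
proof (rule fun_vs.subspaceI)
  show "0 \<in> alt_pairs p q"
    by (simp add: alt_pairs_def)
  fix w assume w: "w \<in> alt_pairs p q"
  show "fun_scale c w \<in> alt_pairs p q" for c
    by (rule alt_pairsI) (auto simp: fun_scale_def alt_pairs_outside[OF w],
      subst alt_pairs_swap[OF w], simp)
  fix w' assume w': "w' \<in> alt_pairs p q"
  show "w + w' \<in> alt_pairs p q"
    by (rule alt_pairsI) (auto simp: alt_pairs_outside[OF w] alt_pairs_outside[OF w'],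
      subst alt_pairs_swap[OF w], subst alt_pairs_swap[OF w'], simp add: algebra_simps)
qed

lemma subspace_alt_pairs_part: "fun_vs.subspace (alt_pairs_part p q a)"
proof (rule fun_vs.subspaceI)
  note sub = subspace_alt_pairs[of p q]
  show "0 \<in> alt_pairs_part p q a"
    using fun_vs.subspace_0[OF sub] by (simp add: alt_pairs_part_def)
  fix w assume w: "w \<in> alt_pairs_part p q a"
  then show "fun_scale c w \<in> alt_pairs_part p q a" for c
    using fun_vs.subspace_scale[OF sub] by (simp add: alt_pairs_part_def fun_scale_def)
  fix w' assume "w' \<in> alt_pairs_part p q a"
  with w show "w + w' \<in> alt_pairs_part p q a"
    using fun_vs.subspace_add[OF sub] by (simp add: alt_pairs_part_def)
qed

text \<open>Swapping the indices i and j exchanges the two sums of \<open>tensor_act\<close>. The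
  sign there is attached to each matrix entry, so \<open>X\<close> may be inhomogeneous.\<close>

lemma tensor_act_alt_pairs:
  assumes w: "w \<in> alt_pairs p q"
  shows "tensor_act p q X w \<in> alt_pairs p q"
proof (rule alt_pairsI)
  note alt = alt_pairs_swap[OF w]
  show "tensor_act p q X w (k, j, i) = - super_sign (deg p i) (deg p j) * tensor_act p q X w (k, i, j)"
    if "i < p + q" "j < p + q" for k i j
  proof -
    have 1: "(\<Sum>l<p + q. X $$ (j, l) * w (k, l, i)) = - super_sign (deg p i) (deg p j) *
        (\<Sum>l<p + q. super_sign (deg p i) (deg p j + deg p l) * (w (k, i, l) * X $$ (j, l)))"
      unfolding sum_distrib_left
      by (intro sum.cong refl, subst alt[of _ _ i]) (simp add: super_sign_add_right)
    have 2: "(\<Sum>l<p + q. super_sign (deg p j) (deg p i + deg p l) * (w (k, j, l) * X $$ (i, l))) =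
        - super_sign (deg p i) (deg p j) * (\<Sum>l<p + q. X $$ (i, l) * w (k, l, j))"
      unfolding sum_distrib_left
      by (intro sum.cong refl, subst alt[of _ j])
        (simp add: super_sign_add_right super_sign_commute[of "deg p j"] mult_ac)
    show ?thesis
      using that 1 2 by (simp add: tensor_act_def algebra_simps)
  qed
  show "tensor_act p q X w (k, i, j) = 0" if "\<not> (k < 2 \<and> i < p + q \<and> j < p + q)" for k i j
    using that by (auto simp: tensor_act_def alt_pairs_outside[OF w])
qed

lemma tensor_act_alt_pairs_part:
  assumes X: "X \<in> gl_part p q a" and w: "w \<in> alt_pairs_part p q b"
  shows "tensor_act p q X w \<in> alt_pairs_part p q (a + b)"
proof -
  have "tensor_act p q X w (k, i, j) = 0" if deg: "deg p i + deg p j \<noteq> a + b" for k i j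
  proof (cases "i < p + q \<and> j < p + q")
    case True
    have "X $$ (i, l) * w (k, l, j) = 0" "w (k, i, l) * X $$ (j, l) = 0" if "l < p + q" for l
    proof -
      have "\<not> (deg p i + deg p l = a \<and> deg p l + deg p j = b)"
        "\<not> (deg p i + deg p l = b \<and> deg p j + deg p l = a)"
        using deg by (auto simp: deg_def)
      then show "X $$ (i, l) * w (k, l, j) = 0" "w (k, i, l) * X $$ (j, l) = 0"
        using X w True that unfolding gl_part_iff alt_pairs_part_def mem_Collect_eq
        by (metis mult_eq_0_iff)+
    qed
    then have "(\<Sum>l<p + q. X $$ (i, l) * w (k, l, j)) = 0" "(\<Sum>l<p + q. w (k, i, l) * X $$ (j, l)) = 0"
      by (auto intro!: sum.neutral simp del: mult_eq_0_iff)
    then show ?thesis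
      using True by (simp add: tensor_act_part[OF X])
  qed (auto simp: tensor_act_def)
  then show ?thesis
    using tensor_act_alt_pairs w unfolding alt_pairs_part_def by auto
qed

section \<open>The orbit of the Kronecker pencil\<close>

text \<open>With \<open>0 \<le> i \<le> m\<close> indexing the even and \<open>m < i \<le> 2 * m\<close> the odd basis vectors, the two
  components (\<open>k = 0, 1\<close>) are the \<open>(m + 1) \<times> m\<close> matrices \<open>P\<close> (identity above a zero row) and \<open>Q\<close> (zero
  row above the identity), placed in the off-diagonal blocks.\<close>

definition kronecker_pencil :: "nat \<Rightarrow> nat \<times> nat \<times> nat \<Rightarrow> complex" where
  "kronecker_pencil m = (\<lambda>(k, i, j).
     if k < 2 \<and> j + k = i + m + 1 \<and> k \<le> i \<and> i < m + k then 1
     else if k < 2 \<and> i + k = j + m + 1 \<and> k \<le> j \<and> j < m + k then -1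
     else 0)"

lemma kronecker_pencil_part: "kronecker_pencil m \<in> alt_pairs_part (m + 1) m 1"
proof -
  have "kronecker_pencil m \<in> alt_pairs (m + 1) m"
    by (rule alt_pairsI) (auto simp: kronecker_pencil_def deg_def)
  then show ?thesis
    by (auto simp: alt_pairs_part_def kronecker_pencil_def deg_def)
qed

text \<open>Every row and column of each component of the pencil has at most one nonzero entry, so
  each sum collapses to one entry of \<open>X\<close>. The final \<open>else 0\<close> covers the
  zero rows: index m for k = 0 and index 0 for k = 1.\<close>

lemma tensor_act_kronecker_pencil:
  assumes "k < 2" "i < 2 * m + 1" "j < 2 * m + 1"
  shows "tensor_act (m + 1) m X (kronecker_pencil m) (k, i, j) =
    (if m < j then X $$ (i, j + k - m - 1) else if k \<le> j \<and> j < m + k then - X $$ (i, j + m + 1 - k) else 0) +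
    (if m < i then - super_sign 1 (deg (m + 1) j) * X $$ (j, i + k - m - 1)
     else if k \<le> i \<and> i < m + k then X $$ (j, i + m + 1 - k) else 0)"
proof -
  let ?N = "{..<m + 1 + m}" and ?v = "kronecker_pencil m"
  have 1: "(\<Sum>l\<in>?N. X $$ (i, l) * ?v (k, l, j)) =
     (if m < j then X $$ (i, j + k - m - 1) else if k \<le> j \<and> j < m + k then - X $$ (i, j + m + 1 - k) else 0)"
  proof -
    consider "m < j" | "k \<le> j" "j < m + k" "j \<le> m" | "\<not> m < j" "\<not> (k \<le> j \<and> j < m + k)"
      by linarith
    then show ?thesis
    proof cases
      case 1
      then have "?v (k, l, j) = (if l = j + k - m - 1 then 1 else 0)" if "l < m + 1 + m" for l
        using assms that by (auto simp: kronecker_pencil_def)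
      then have "(\<Sum>l\<in>?N. X $$ (i, l) * ?v (k, l, j)) =
          (\<Sum>l\<in>?N. if l = j + k - m - 1 then X $$ (i, l) else 0)"
        by (intro sum.cong refl) auto
      then show ?thesis
        using 1 assms by simp
    next
      case 2
      then have "?v (k, l, j) = (if l = j + m + 1 - k then -1 else 0)" if "l < m + 1 + m" for l
        using assms that by (auto simp: kronecker_pencil_def)
      then have "(\<Sum>l\<in>?N. X $$ (i, l) * ?v (k, l, j)) =
          (\<Sum>l\<in>?N. if l = j + m + 1 - k then - X $$ (i, l) else 0)"
        by (intro sum.cong refl) auto
      moreover have "j + m + 1 - k < m + 1 + m"
        using 2 by arith
      ultimately show ?thesis
        using 2 by (simp del: sum.lessThan_Suc)
    next
      case 3
      then have "?v (k, l, j) = 0" if "l < m + 1 + m" for l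
        using assms that by (auto simp: kronecker_pencil_def)
      then show ?thesis
        using 3 by auto
    qed
  qed
  have 2: "(\<Sum>l\<in>?N. super_sign (deg (m + 1) i) (deg (m + 1) j + deg (m + 1) l) * (?v (k, i, l) * X $$ (j, l))) =
    (if m < i then - super_sign 1 (deg (m + 1) j) * X $$ (j, i + k - m - 1)
     else if k \<le> i \<and> i < m + k then X $$ (j, i + m + 1 - k) else 0)"
  proof -
    consider "m < i" | "k \<le> i" "i < m + k" "i \<le> m" | "\<not> m < i" "\<not> (k \<le> i \<and> i < m + k)"
      by linarith
    then show ?thesis
    proof cases
      case 1
      then have "?v (k, i, l) = (if l = i + k - m - 1 then -1 else 0)" if "l < m + 1 + m" for l
        using assms that by (auto simp: kronecker_pencil_def)
      then have "(\<Sum>l\<in>?N. super_sign (deg (m + 1) i) (deg (m + 1) j + deg (m + 1) l) * (?v (k, i, l) * X $$ (j, l))) =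
          (\<Sum>l\<in>?N. if l = i + k - m - 1 then - super_sign 1 (deg (m + 1) j) * X $$ (j, l) else 0)"
        using 1 assms by (intro sum.cong refl) (auto simp: deg_def)
      then show ?thesis
        using 1 assms by simp
    next
      case 2
      then have "?v (k, i, l) = (if l = i + m + 1 - k then 1 else 0)" if "l < m + 1 + m" for l
        using assms that by (auto simp: kronecker_pencil_def)
      then have "(\<Sum>l\<in>?N. super_sign (deg (m + 1) i) (deg (m + 1) j + deg (m + 1) l) * (?v (k, i, l) * X $$ (j, l))) =
          (\<Sum>l\<in>?N. if l = i + m + 1 - k then X $$ (j, l) else 0)"
        using 2 by (intro sum.cong refl) (auto simp: deg_def)
      moreover have "i + m + 1 - k < m + 1 + m"
        using 2 by arith
      ultimately show ?thesis
        using 2 by (simp del: sum.lessThan_Suc)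
    next
      case 3
      then have "?v (k, i, l) = 0" if "l < m + 1 + m" for l
        using assms that by (auto simp: kronecker_pencil_def)
      then show ?thesis
        using 3 by auto
    qed
  qed
  show ?thesis
    unfolding tensor_act_def using assms 1 2 by simp
qed

lemma kronecker_orbit_inj:
  assumes X: "X \<in> carrier_mat (m + 1 + m) (m + 1 + m)" and tr: "supertrace (m + 1) X = 0"
    and zero: "tensor_act (m + 1) m X (kronecker_pencil m) = 0"
  shows "X = 0\<^sub>m (m + 1 + m) (m + 1 + m)"
proof -
  \<comment> \<open>The system decouples by index parities: even-odd entries involve only the two
    diagonal blocks, even-even entries only the upper right block, and odd-odd entries only the
    lower left block.\<close>
  note act = tensor_act_kronecker_pencil[of _ _ m _ X, unfolded zero]
  have A: "\<And>i j. \<lbrakk>i \<le> m; j \<le> m\<rbrakk> \<Longrightarrow> X $$ (i, j) = 0"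
    and D: "\<And>s t. \<lbrakk>s < m; t < m\<rbrakk> \<Longrightarrow> X $$ (m + 1 + s, m + 1 + t) = 0"
  proof -
    let ?A = "\<lambda>i j. X $$ (i, j)" and ?D = "\<lambda>s t. X $$ (m + 1 + s, m + 1 + t)"
    have 1: "?A i t + (if i < m then ?D t i else 0) = 0" if "i \<le> m" "t < m" for i t
      using act[of 0 i "m + 1 + t"] that by (auto simp: add_ac split: if_splits)
    have 2: "?A i (Suc t) + (if 1 \<le> i then ?D t (i - 1) else 0) = 0" if "i \<le> m" "t < m" for i t
      using act[of 1 i "m + 1 + t"] that by (auto simp: add_ac split: if_splits)
    have 3: "(\<Sum>i<Suc m. ?A i i) = (\<Sum>t<m. ?D t t)"
      using tr supertrace_eq[OF X] by simp
    show "X $$ (i, j) = 0" if "i \<le> m" "j \<le> m" for i j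
      using that by (intro toeplitz_traceless_zero(1)[of m ?A ?D] 1 2 3)
    show "X $$ (m + 1 + s, m + 1 + t) = 0" if "s < m" "t < m" for s t
      using that by (intro toeplitz_traceless_zero(2)[of m ?A ?D] 1 2 3)
  qed
  have B: "X $$ (i, m + 1 + j) = 0" if "i \<le> m" "j < m" for i j
  proof -
    let ?B = "\<lambda>i j. X $$ (i, m + 1 + j)"
    have 1: "(if j < m then ?B i j else 0) = (if i < m then ?B j i else 0)" if "i \<le> m" "j \<le> m" for i j
      using act[of 0 i j] that by (auto simp: add_ac split: if_splits)
    have 2: "(if 1 \<le> j then ?B i (j - 1) else 0) = (if 1 \<le> i then ?B j (i - 1) else 0)"
      if "i \<le> m" "j \<le> m" for i j
      using act[of 1 i j] that by (auto simp: add_ac split: if_splits)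
    show ?thesis
      using that by (intro antidiagonal_symmetric_zero[of m ?B] 1 2)
  qed
  have C: "X $$ (m + 1 + s, t) = 0" if "s < m" "t \<le> m" for s t
  proof -
    let ?C = "\<lambda>s t. X $$ (m + 1 + s, t)"
    have 1: "?C s t + ?C t s = 0" if "s < m" "t < m" for s t
      using act[of 0 "m + 1 + s" "m + 1 + t"] that by (simp add: deg_def)
    have 2: "?C s (Suc t) + ?C t (Suc s) = 0" if "s < m" "t < m" for s t
      using act[of 1 "m + 1 + s" "m + 1 + t"] that by (simp add: deg_def)
    show ?thesis
      using that by (intro antidiagonal_alternating_zero[of m ?C] 1 2)
  qed
  show ?thesis
  proof (rule eq_matI)
    fix i j assume "i < dim_row (0\<^sub>m (m + 1 + m) (m + 1 + m) :: complex mat)"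
      "j < dim_col (0\<^sub>m (m + 1 + m) (m + 1 + m) :: complex mat)"
    then have ij: "i < m + 1 + m" "j < m + 1 + m"
      by simp_all
    have "X $$ (i, j) = 0"
      using ij A[of i j] B[of i "j - (m + 1)"] C[of "i - (m + 1)" j] D[of "i - (m + 1)" "j - (m + 1)"]
      by (cases "i \<le> m"; cases "j \<le> m") auto
    then show "X $$ (i, j) = 0\<^sub>m (m + 1 + m) (m + 1 + m) $$ (i, j)"
      using ij by simp
  qed (use X in auto)
qed

text \<open>The independent entries of an element of \<^const>\<open>alt_pairs\<close> are put in distinct
  positions of a matrix, and the entry \<open>(m, m)\<close> is chosen so that the
  supertrace vanishes. This injective linear map replaces the comparison of the dimensions
  of \<open>sl(m + 1 | m)\<close> and \<^const>\<open>alt_pairs\<close>.\<close>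

definition alt_pairs_mat :: "nat \<Rightarrow> (nat \<times> nat \<times> nat \<Rightarrow> complex) \<Rightarrow> complex mat" where
  "alt_pairs_mat m w = mat (m + 1 + m) (m + 1 + m) (\<lambda>(i, j).
     if i \<le> m then
       (if j < m then w (0, i, m + 1 + j)
        else if j = m then
          (if i < m then w (1, m, m + 1 + i)
           else (\<Sum>t<m. w (1, t, m + 1 + t)) - (\<Sum>t<m. w (0, t, m + 1 + t)))
        else if m + i + 1 > j then w (0, i, j - m - 1) else w (1, i, j - m))
     else
       (if m < j then w (1, i - m - 1, j)
        else if m + 1 + j \<le> i then w (0, i, m + 1 + j) else w (1, i, m + j)))"

lemma alt_pairs_mat_carrier: "alt_pairs_mat m w \<in> carrier_mat (m + 1 + m) (m + 1 + m)"
  by (simp add: alt_pairs_mat_def)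

lemma supertrace_alt_pairs_mat: "supertrace (m + 1) (alt_pairs_mat m w) = 0"
  unfolding supertrace_eq[OF alt_pairs_mat_carrier] by (simp add: alt_pairs_mat_def)

lemma alt_pairs_mat_add: "alt_pairs_mat m (w + w') = alt_pairs_mat m w + alt_pairs_mat m w'"
  by (rule eq_matI) (auto simp: alt_pairs_mat_def sum.distrib)

lemma alt_pairs_mat_scale: "alt_pairs_mat m (fun_scale c w) = c \<cdot>\<^sub>m alt_pairs_mat m w"
  by (rule eq_matI) (auto simp: alt_pairs_mat_def fun_scale_def sum_distrib_left right_diff_distrib)

lemma alt_pairs_mat_inj:
  assumes w: "w \<in> alt_pairs (m + 1) m"
    and zero: "alt_pairs_mat m w = 0\<^sub>m (m + 1 + m) (m + 1 + m)"
  shows "w = 0"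
proof -
  note alt = alt_pairs_swap[OF w]
  have entry: "alt_pairs_mat m w $$ (i, j) = 0" if "i < m + 1 + m" "j < m + 1 + m" for i j
    using that unfolding zero by simp
  have mixed0: "w (0, i, m + 1 + t) = 0" if "i \<le> m" "t < m" for i t
    using entry[of i t] that by (simp add: alt_pairs_mat_def)
  \<comment> \<open>The rows i < m of this component fill the lower right block of the matrix; its
    last row is stored in column m, above the entry (m, m).\<close>
  have mixed1: "w (1, i, m + 1 + t) = 0" if "i \<le> m" "t < m" for i t
    using entry[of "m + 1 + i" "m + 1 + t"] entry[of t m] that
    by (cases "i = m") (auto simp: alt_pairs_mat_def)
  have even0: "w (0, i, j) = 0" if "i \<le> m" "j < i" for i j
    using entry[of i "m + 1 + j"] that by (simp add: alt_pairs_mat_def)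
  have even1: "w (1, i, j) = 0" if "j \<le> m" "i < j" for i j
    using entry[of i "m + j"] that by (simp add: alt_pairs_mat_def)
  have diag: "w (k, i, i) = 0" if "i \<le> m" for k i
    using alt[of k i i] that by (simp add: deg_def flip: mult_2)
  have odd0: "w (0, m + 1 + s, m + 1 + t) = 0" if "s < m" "t \<le> s" for s t
    using entry[of "m + 1 + s" t] that by (simp add: alt_pairs_mat_def)
  have odd1: "w (1, m + 1 + s, m + 1 + t) = 0" if "t < m" "s \<le> t" for s t
    using entry[of "m + 1 + s" "t + 1"] that by (simp add: alt_pairs_mat_def)
  have mixed: "w (k, i, m + 1 + t) = 0" if "k < 2" "i \<le> m" "t < m" for k i t
    using mixed0 mixed1 that by (metis One_nat_def less_2_cases)
  have even: "w (k, i, j) = 0" if "k < 2" "i \<le> m" "j \<le> m" for k i j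
    using that even0[of i j] even1[of j i] even0[of j i] even1[of i j] diag[of i k] alt[of k i j]
    by (cases i j rule: linorder_cases) (auto simp: less_2_cases_iff)
  have odd: "w (k, m + 1 + s, m + 1 + t) = 0" if "k < 2" "s < m" "t < m" for k s t
    using that odd0[of s t] odd0[of t s] odd1[of s t] odd1[of t s] alt[of k "m + 1 + s" "m + 1 + t"]
    by (cases s t rule: linorder_le_cases) (auto simp: less_2_cases_iff)
  have "w (k, i, j) = 0" for k i j
  proof (cases "k < 2 \<and> i < m + 1 + m \<and> j < m + 1 + m")
    case True
    consider "i \<le> m" "j \<le> m" | t where "i \<le> m" "j = m + 1 + t" | s where "i = m + 1 + s" "j \<le> m"
      | s t where "i = m + 1 + s" "j = m + 1 + t"
      by (metis Suc_eq_plus1 less_eq_Suc_le le_iff_add not_le)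
    then show ?thesis
      using True even mixed odd alt[of k i j] by cases (auto simp del: One_nat_def)
  qed (use alt_pairs_outside[OF w] in blast)
  then show ?thesis
    by (auto simp: fun_eq_iff)
qed

text \<open>The orbit map composed with \<open>alt_pairs_mat\<close> is an injective endomorphism of
  the finite-dimensional space \<open>alt_pairs\<close>, hence onto, and all its values are orbit
  values of elements of sl(m+1|m).\<close>

lemma kronecker_orbit_surj:
  assumes w: "w \<in> alt_pairs (m + 1) m"
  shows "\<exists>X \<in> carrier (sl_super (m + 1) m). tensor_act (m + 1) m X (kronecker_pencil m) = w"
proof -
  let ?V = "alt_pairs (m + 1) m" and ?n = "m + 1 + m"
  define f where "f w = tensor_act (m + 1) m (alt_pairs_mat m w) (kronecker_pencil m)" for w
  have lin: "Vector_Spaces.linear fun_scale fun_scale f"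
    by unfold_locales
      (simp_all only: f_def alt_pairs_mat_add alt_pairs_mat_scale
        tensor_act_add_left[OF alt_pairs_mat_carrier alt_pairs_mat_carrier]
        tensor_act_smult_left[OF alt_pairs_mat_carrier])
  interpret f: Vector_Spaces.linear fun_scale fun_scale f
    by (fact lin)
  have "f ` ?V = ?V"
  proof (rule fun_vs.linear_inj_on_subspace_imp_surj[OF lin subspace_alt_pairs])
    let ?F = "{..<2::nat} \<times> {..<?n} \<times> {..<?n}"
    show "finite ((\<lambda>i j. if j = i then 1 else 0 :: complex) ` ?F)"
      by simp
    show "?V \<subseteq> fun_vs.span ((\<lambda>i j. if j = i then 1 else 0) ` ?F)"
    proof (intro subsetI finite_support_in_span)
      fix w i assume "w \<in> ?V" "i \<notin> ?F"
      then show "w i = 0"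
        by (cases i) (auto intro: alt_pairs_outside)
    qed simp
    show "f ` ?V \<subseteq> ?V"
      using kronecker_pencil_part unfolding f_def alt_pairs_part_def
      by (auto intro: tensor_act_alt_pairs)
    have "w = 0" if "w \<in> ?V" "f w = 0" for w
      using alt_pairs_mat_inj[OF that(1) kronecker_orbit_inj[OF alt_pairs_mat_carrier supertrace_alt_pairs_mat]]
        that(2) by (simp only: f_def)
    then show "inj_on f ?V"
      using f.inj_on_iff_eq_0[OF subspace_alt_pairs] by blast
  qed
  then obtain u where "f u = w"
    using w by (metis imageE)
  then show ?thesis
    unfolding f_def sl_super_simps using alt_pairs_mat_carrier supertrace_alt_pairs_mat by blast
qed

theorem theorem1p4:
  fixes m :: nat
  assumes "m \<ge> 1"
  shows "\<exists>p. lssa_on (sl_super (m + 1) m) p"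
proof -
  let ?p = "m + 1"
  interpret superalgebra "sl_super ?p m"
    by (rule superalgebra_sl_super)
  interpret etale_module "sl_super ?p m" fun_scale "tensor_act ?p m" "alt_pairs_part ?p m" "kronecker_pencil m"
  proof
    have "w (k, i, j) = 0" if "w \<in> alt_pairs_part ?p m 0" "w \<in> alt_pairs_part ?p m 1" for w k i j
      using that by (cases "deg ?p i + deg ?p j = 0") (auto simp: alt_pairs_part_def)
    then show "alt_pairs_part ?p m 0 \<inter> alt_pairs_part ?p m 1 = {0}"
      using fun_vs.subspace_0[OF subspace_alt_pairs_part] by (auto simp: fun_eq_iff)
    have v: "kronecker_pencil m \<in> alt_pairs ?p m"
      using kronecker_pencil_part by (simp add: alt_pairs_part_def)
    \<comment> \<open>The action preserves \<open>alt_pairs\<close>, and every vector of that space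
      is an orbit value.\<close>
    show "\<exists>z \<in> carrier (sl_super ?p m). tensor_act ?p m z (kronecker_pencil m) =
        tensor_act ?p m x (tensor_act ?p m y (kronecker_pencil m))" for x y
      by (intro kronecker_orbit_surj tensor_act_alt_pairs v)
  qed (auto simp: tensor_act_add_left tensor_act_smult_left tensor_act_add_right
      tensor_act_scale_right tensor_act_bracket subspace_alt_pairs_part kronecker_pencil_part[simplified]
      intro: tensor_act_alt_pairs_part kronecker_orbit_inj[simplified])
  show ?thesis
    using lssa_on_orbit_prod by blast
qed

end
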